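(* Let $\tau$ be a finite relational vocabulary and let $\mathcal{M}=\{\neg,\land,\forall,\exists\}$ (regarded as minor quantifiers), with costs $s(=)=s(R)=s(\neg)=s(\land)=0$ for all $R\in\tau$ and $s(\forall)=s(\exists)=1$. Let $\mathcal{A}$ and $\mathcal{B}$ be classes of $\tau$-pairs and let $b\in\mathbb{N}$ be a budget. Then Player $\mathbb{I}$ has a winning strategy in the $\mathrm{EF}_b\{\mathcal{M}\}(\mathcal{A},\mathcal{B})$-game if and only if $\mathcal{A}$ and $\mathcal{B}$ are separable by an $\mathrm{FO}(\mathcal{M})$-formula of quantifier rank $\leq b$.
   Context: **Logic.** $\tau$ is a finite set of relation symbols with arities in $\mathbb{N}$. A $\tau$-model $\mathfrak{A}$ has a non-empty, possibly infinite domain $A$ and a relation $R^{\mathfrak{A}}\subseteq A^k$ for each $k$-ary $R\in\tau$. An assignment over $\mathfrak{A}$ is a (possibly empty) function $f:X\to A$ with $X\subseteq\mathrm{VAR}$ finite, $\mathrm{VAR}$ being a countably infinite set of variables. $h\frac{\mathbf{c}}{\mathbf{x}}$ is $h$ modified to send $\mathbf{x}$ to $\mathbf{c}$ (for empty tuples it is $h$). A $\tau$-pair is a pair $(\mathfrak{A},f)$ with $f$ an assignment over the $\tau$-model $\mathfrak{A}$. $\mathrm{FO}(\mathcal{M})$ is first-order logic with equality over $\tau$ with primitives $\neg,\land,\forall,\exists$; replacing a generalized quantifier by any of its minors (see below) does not change the meaning of formulas, so its semantics is the ordinary one. The quantifier rank of a formula is the maximum number of nested occurrences of $\forall,\exists$.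 In $\mathfrak{A},f\models\varphi$, $\mathrm{dom}(f)$ contains the free variables of $\varphi$. A formula $\varphi$ separates $\mathcal{A}$ and $\mathcal{B}$ if $\mathfrak{A},f\models\varphi$ for all $(\mathfrak{A},f)\in\mathcal{A}$ and $\mathfrak{B},g\not\models\varphi$ for all $(\mathfrak{B},g)\in\mathcal{B}$. **Minor quantifiers.** A generalized quantifier of width $k$ and type $\mathbf{n}\in\mathbb{N}^k$ is an isomorphism-closed class $Q$ of structures $(D,P_1,\dots,P_k)$ with $D\neq\emptyset$ and $P_j\subseteq D^{\mathbf{n}(j)}$, where $D^0=\{\emptyset\}$; $\overline{Q}$ is its complement among such structures. An isomorphism-closed class $\mathcal{C}$ of structures $(D,P_+^1,\dots,P_+^k,P_-^1,\dots,P_-^k)$ *witnesses* $Q$ if: (1) for each member, $D\neq\emptyset$ and, for each $j$, $P_+^j\cup P_-^j\subseteq D^{\mathbf{n}(j)}$ and $P_+^j\cap P_-^j=\emptyset$; (2) for each $(D,P_1,\dots,P_k)\in Q$ there is $(D,P_+^1,\dots,P_+^k,P_-^1,\dots,P_-^k)\in\mathcal{C}$ with $P_+^j\subseteq P_j$ and $P_-^j\subseteq D^{\mathbf{n}(j)}\setminus P_j$ for all $j$; (3) for each $(D,P_+^1,\dots,P_+^k,P_-^1,\dots,P_-^k)\in\mathcal{C}$ there is no $(D,P_1,\dots,P_k)\in\overline{Q}$ with $P_+^j\subseteq P_j$ and $P_-^j\subseteq D^{\mathbf{n}(j)}\setminus P_j$ for all $j$. A *minor* of $Q$ is a pair $M=(\mathcal{C},\mathcal{D})$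 where $\mathcal{C}$ witnesses $Q$ and $\mathcal{D}$ witnesses $\overline{Q}$; it has the width and type of $Q$. As generalized quantifiers: $\neg$ has width $1$, type $(0)$, and $(D,P)\in\neg$ iff $P=\emptyset$; $\land$ has width $2$, type $(0,0)$, and $(D,P_1,P_2)\in\land$ iff $P_1=P_2=\{\emptyset\}$; $\exists$ and $\forall$ have width $1$, type $(1)$, with $(D,P)\in\exists$ iff $P\ne\emptyset$ and $(D,P)\in\forall$ iff $P=D$. Each member of $\mathcal{M}$ is a minor of the generalized quantifier with the same symbol. **The game.** $\mathrm{EF}_b\{\mathcal{M}\}(\mathcal{A},\mathcal{B})$ is a two-player game starting in position $(b,\mathcal{A},\mathcal{B})$. A round from position $(s_i,\mathcal{A}_i,\mathcal{B}_i)$ goes as follows. 1. If $s_i<0$ (the smallest cost of an atomic formula being $0$), Player $\mathbb{II}$ wins. Otherwise Player $\mathbb{I}$ chooses an atomic formula $\varphi$. If $\varphi$ separates $\mathcal{A}_i$ and $\mathcal{B}_i$, Player $\mathbb{I}$ wins; otherwise the round continues. 2. Player $\mathbb{I}$ chooses $M=(\mathcal{C},\mathcal{D})\in\mathcal{M}$ of width $k$ and type $\mathbf{n}$ and tuples $\mathbf{x}_j\in\mathrm{VAR}^{\mathbf{n}(j)}$ ($1\le j\le k$). For each $j$ and each $(\mathfrak{A},f)\in\mathcal{A}_i$ he chooses a witness set $P_{j,+}^{\mathfrak{A},f}\subseteq A^{\mathbf{n}(j)}$ and a falsifier set $P_{j,-}^{\mathfrak{A},f}\subseteq A^{\mathbf{n}(j)}$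 such that $(A,P_{1,+}^{\mathfrak{A},f},\dots,P_{k,+}^{\mathfrak{A},f},P_{1,-}^{\mathfrak{A},f},\dots,P_{k,-}^{\mathfrak{A},f})\in\mathcal{C}$; for each $j$ and each $(\mathfrak{B},g)\in\mathcal{B}_i$ he likewise chooses $P_{j,+}^{\mathfrak{B},g},P_{j,-}^{\mathfrak{B},g}\subseteq B^{\mathbf{n}(j)}$ such that $(B,P_{1,+}^{\mathfrak{B},g},\dots,P_{k,+}^{\mathfrak{B},g},P_{1,-}^{\mathfrak{B},g},\dots,P_{k,-}^{\mathfrak{B},g})\in\mathcal{D}$. If such choices do not exist, Player $\mathbb{II}$ wins immediately. 3. Player $\mathbb{II}$ chooses $j\in\{1,\dots,k\}$. The next position is $(s_i-s(M),\mathcal{A}'_j,\mathcal{B}'_j)$ (the budget is copied into every branch rather than split), where $\mathcal{A}'_j=\{(\mathfrak{C},h\frac{\mathbf{c}}{\mathbf{x}_j})\mid(\mathfrak{C},h)\in\mathcal{A}_i\cup\mathcal{B}_i,\ \mathbf{c}\in P_{j,+}^{\mathfrak{C},h}\}$ and $\mathcal{B}'_j=\{(\mathfrak{C},h\frac{\mathbf{c}}{\mathbf{x}_j})\mid(\mathfrak{C},h)\in\mathcal{A}_i\cup\mathcal{B}_i,\ \mathbf{c}\in P_{j,-}^{\mathfrak{C},h}\}$. Player $\mathbb{II}$ wins every infinite play.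
   Formalization: The formal theorem additionally assumes that all assignments in the classes A and B have the same domain; without this, Player I can win although no formula whose free variables lie in every assignment's domain separates A and B. *)

theory Defs
  imports Main
begin

section \<open>First-order logic over a relational vocabulary\<close>

text \<open>
  A vocabulary is a set \<open>\<tau>\<close> of relation symbols together with an arity function \<open>ar\<close>.
  Tuples are lists, so \<open>D\<^sup>0\<close> is \<open>{[]}\<close>.  Variables are natural numbers.
\<close>

type_synonym var = nat

definition tuples :: "'a set \<Rightarrow> nat \<Rightarrow> 'a list set" where
  "tuples D n = {as. length as = n \<and> set as \<subseteq> D}"

record ('r, 'a) model =
  univ :: "'a set"
  interp :: "'r \<Rightarrow> 'a list set"

text \<open>
  The last conjunct only makes models canonical: nothing is interpreted outside \<open>\<tau>\<close>.
\<close>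

definition tau_model :: "'r set \<Rightarrow> ('r \<Rightarrow> nat) \<Rightarrow> ('r, 'a) model \<Rightarrow> bool" where
  "tau_model \<tau> ar \<AA> \<longleftrightarrow> univ \<AA> \<noteq> {} \<and>
     (\<forall>R\<in>\<tau>. interp \<AA> R \<subseteq> tuples (univ \<AA>) (ar R)) \<and> (\<forall>R. R \<notin> \<tau> \<longrightarrow> interp \<AA> R = {})"

type_synonym 'a assignment = "var \<rightharpoonup> 'a"

type_synonym ('r, 'a) mpair = "('r, 'a) model \<times> 'a assignment"

definition tau_pairs :: "'r set \<Rightarrow> ('r \<Rightarrow> nat) \<Rightarrow> ('r, 'a) mpair set" where
  "tau_pairs \<tau> ar = {(\<AA>, f). tau_model \<tau> ar \<AA> \<and> finite (dom f) \<and> ran f \<subseteq> univ \<AA>}"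

datatype 'r fm =
    Eq var var
  | Rel 'r "var list"
  | Neg "'r fm"
  | Conj "'r fm" "'r fm"
  | Forall var "'r fm"
  | Exists var "'r fm"

primrec tau_fm :: "'r set \<Rightarrow> ('r \<Rightarrow> nat) \<Rightarrow> 'r fm \<Rightarrow> bool" where
  "tau_fm \<tau> ar (Eq x y) \<longleftrightarrow> True"
| "tau_fm \<tau> ar (Rel R xs) \<longleftrightarrow> R \<in> \<tau> \<and> length xs = ar R"
| "tau_fm \<tau> ar (Neg \<phi>) \<longleftrightarrow> tau_fm \<tau> ar \<phi>"
| "tau_fm \<tau> ar (Conj \<phi> \<psi>) \<longleftrightarrow> tau_fm \<tau> ar \<phi> \<and> tau_fm \<tau> ar \<psi>"
| "tau_fm \<tau> ar (Forall x \<phi>) \<longleftrightarrow> tau_fm \<tau> ar \<phi>"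
| "tau_fm \<tau> ar (Exists x \<phi>) \<longleftrightarrow> tau_fm \<tau> ar \<phi>"

definition tau_atom :: "'r set \<Rightarrow> ('r \<Rightarrow> nat) \<Rightarrow> 'r fm \<Rightarrow> bool" where
  "tau_atom \<tau> ar \<phi> \<longleftrightarrow> tau_fm \<tau> ar \<phi> \<and> ((\<exists>x y. \<phi> = Eq x y) \<or> (\<exists>R xs. \<phi> = Rel R xs))"

primrec fv :: "'r fm \<Rightarrow> var set" where
  "fv (Eq x y) = {x, y}"
| "fv (Rel R xs) = set xs"
| "fv (Neg \<phi>) = fv \<phi>"
| "fv (Conj \<phi> \<psi>) = fv \<phi> \<union> fv \<psi>"
| "fv (Forall x \<phi>) = fv \<phi> - {x}"
| "fv (Exists x \<phi>) = fv \<phi> - {x}"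

primrec qrank :: "'r fm \<Rightarrow> nat" where
  "qrank (Eq x y) = 0"
| "qrank (Rel R xs) = 0"
| "qrank (Neg \<phi>) = qrank \<phi>"
| "qrank (Conj \<phi> \<psi>) = max (qrank \<phi>) (qrank \<psi>)"
| "qrank (Forall x \<phi>) = Suc (qrank \<phi>)"
| "qrank (Exists x \<phi>) = Suc (qrank \<phi>)"

text \<open>
  Satisfaction is meaningful only if \<open>fv \<phi> \<subseteq> dom f\<close>.  This proviso is imposed in
  \<open>separates\<close>, the only place where satisfaction is used.
\<close>

primrec sat :: "('r, 'a) model \<Rightarrow> 'a assignment \<Rightarrow> 'r fm \<Rightarrow> bool" where
  "sat \<AA> f (Eq x y) \<longleftrightarrow> the (f x) = the (f y)"
| "sat \<AA> f (Rel R xs) \<longleftrightarrow> map (\<lambda>x. the (f x)) xs \<in> interp \<AA> R"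
| "sat \<AA> f (Neg \<phi>) \<longleftrightarrow> \<not> sat \<AA> f \<phi>"
| "sat \<AA> f (Conj \<phi> \<psi>) \<longleftrightarrow> sat \<AA> f \<phi> \<and> sat \<AA> f \<psi>"
| "sat \<AA> f (Forall x \<phi>) \<longleftrightarrow> (\<forall>a\<in>univ \<AA>. sat \<AA> (f(x \<mapsto> a)) \<phi>)"
| "sat \<AA> f (Exists x \<phi>) \<longleftrightarrow> (\<exists>a\<in>univ \<AA>. sat \<AA> (f(x \<mapsto> a)) \<phi>)"

definition separates :: "'r fm \<Rightarrow> ('r, 'a) mpair set \<Rightarrow> ('r, 'a) mpair set \<Rightarrow> bool" where
  "separates \<phi> \<A> \<B> \<longleftrightarrow>
     (\<forall>(\<CC>, h) \<in> \<A> \<union> \<B>. fv \<phi> \<subseteq> dom h) \<and>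
     (\<forall>(\<AA>, f) \<in> \<A>. sat \<AA> f \<phi>) \<and>
     (\<forall>(\<BB>, g) \<in> \<B>. \<not> sat \<BB> g \<phi>)"

text \<open>
  If the assignments in \<open>\<A> \<union> \<B>\<close> have different domains, Player I can win the game below although
  no formula separates: a pair falsifying a conjunction need not enter the branch in which a
  variable is undefined.  For example, with \<open>a \<noteq> b\<close> in one model, playing \<open>x = y \<and> y = z\<close> wins for
  \<open>[x \<mapsto> a, y \<mapsto> a, z \<mapsto> a]\<close> against \<open>[x \<mapsto> a, y \<mapsto> b]\<close> and \<open>[y \<mapsto> a, z \<mapsto> b]\<close>, but a separating formula
  could only have \<open>y\<close> free.  Classes to be separated are therefore taken to have a common domain of
  assignments.
\<close>

section \<open>Generalized quantifiers and their minors\<close>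

text \<open>
  A structure \<open>(D, P\<^sub>1, \<dots>, P\<^sub>k)\<close> is a pair \<open>(D, [P\<^sub>1, \<dots>, P\<^sub>k])\<close>, and
  \<open>(D, P\<^sub>+\<^sup>1, \<dots>, P\<^sub>+\<^sup>k, P\<^sub>-\<^sup>1, \<dots>, P\<^sub>-\<^sup>k)\<close> is a triple
  \<open>(D, [P\<^sub>+\<^sup>1, \<dots>, P\<^sub>+\<^sup>k], [P\<^sub>-\<^sup>1, \<dots>, P\<^sub>-\<^sup>k])\<close>.  A type \<open>n\<close> of width \<open>k\<close> is a list of
  length \<open>k\<close>.  List positions count from \<open>0\<close>.
\<close>

type_synonym 'a gstruct = "'a set \<times> 'a list set list"

type_synonym 'a sstruct = "'a set \<times> 'a list set list \<times> 'a list set list"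

definition gstructs :: "nat list \<Rightarrow> 'a gstruct set" where
  "gstructs n = {(D, Ps). D \<noteq> {} \<and> length Ps = length n \<and>
     (\<forall>j<length n. Ps ! j \<subseteq> tuples D (n ! j))}"

definition sstructs :: "nat list \<Rightarrow> 'a sstruct set" where
  "sstructs n = {(D, Pp, Pm). D \<noteq> {} \<and> length Pp = length n \<and> length Pm = length n \<and>
     (\<forall>j<length n. Pp ! j \<union> Pm ! j \<subseteq> tuples D (n ! j) \<and> Pp ! j \<inter> Pm ! j = {})}"

definition iso_closed :: "'a sstruct set \<Rightarrow> bool" where
  "iso_closed \<C> \<longleftrightarrow> (\<forall>D Pp Pm E \<pi>. (D, Pp, Pm) \<in> \<C> \<and> bij_betw \<pi> D E \<longrightarrow>
     (E, map ((`) (map \<pi>)) Pp, map ((`) (map \<pi>)) Pm) \<in> \<C>)"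

definition compatible :: "nat list \<Rightarrow> 'a set \<Rightarrow> 'a list set list \<Rightarrow> 'a list set list
    \<Rightarrow> 'a list set list \<Rightarrow> bool" where
  "compatible n D Pp Pm Ps \<longleftrightarrow>
     (\<forall>j<length n. Pp ! j \<subseteq> Ps ! j \<and> Pm ! j \<subseteq> tuples D (n ! j) - Ps ! j)"

definition witnesses :: "nat list \<Rightarrow> 'a sstruct set \<Rightarrow> 'a gstruct set \<Rightarrow> bool" where
  "witnesses n \<C> Q \<longleftrightarrow> iso_closed \<C> \<and> \<C> \<subseteq> sstructs n \<and>
     (\<forall>(D, Ps) \<in> Q. \<exists>Pp Pm. (D, Pp, Pm) \<in> \<C> \<and> compatible n D Pp Pm Ps) \<and>
     (\<forall>(D, Pp, Pm) \<in> \<C>. \<not> (\<exists>Ps. (D, Ps) \<in> gstructs n - Q \<and> compatible n D Pp Pm Ps))"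

type_synonym 'a minor = "'a sstruct set \<times> 'a sstruct set"

definition is_minor :: "nat list \<Rightarrow> 'a gstruct set \<Rightarrow> 'a minor \<Rightarrow> bool" where
  "is_minor n Q M \<longleftrightarrow> witnesses n (fst M) Q \<and> witnesses n (snd M) (gstructs n - Q)"

datatype quant = NegQ | ConjQ | ForallQ | ExistsQ

fun qtype :: "quant \<Rightarrow> nat list" where
  "qtype NegQ = [0]"
| "qtype ConjQ = [0, 0]"
| "qtype ForallQ = [1]"
| "qtype ExistsQ = [1]"

fun gquant :: "quant \<Rightarrow> 'a gstruct set" where
  "gquant NegQ = {(D, Ps) \<in> gstructs [0]. Ps ! 0 = {}}"
| "gquant ConjQ = {(D, Ps) \<in> gstructs [0, 0]. Ps ! 0 = {[]} \<and> Ps ! 1 = {[]}}"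
| "gquant ForallQ = {(D, Ps) \<in> gstructs [1]. Ps ! 0 = tuples D 1}"
| "gquant ExistsQ = {(D, Ps) \<in> gstructs [1]. Ps ! 0 \<noteq> {}}"

text \<open>The costs of \<open>=\<close> and of the relation symbols are \<open>0\<close>.\<close>

fun cost :: "quant \<Rightarrow> int" where
  "cost NegQ = 0"
| "cost ConjQ = 0"
| "cost ForallQ = 1"
| "cost ExistsQ = 1"

section \<open>The Ehrenfeucht-Fraisse game\<close>

type_synonym ('r, 'a) position = "int \<times> ('r, 'a) mpair set \<times> ('r, 'a) mpair set"

text \<open>
  Everything Player I chooses in one round.  The function \<open>wit\<close> sends a pair to its list of
  witness sets and its list of falsifier sets.  If the atomic formula separates, the other
  components are irrelevant.
\<close>

record ('r, 'a) move =
  atom :: "'r fm"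
  quan :: quant
  vars :: "var list list"
  wit :: "('r, 'a) mpair \<Rightarrow> 'a list set list \<times> 'a list set list"

text \<open>
  \<open>\<mu> q\<close> is the minor played for the symbol \<open>q\<close>.
\<close>

definition legal_choice ::
    "(quant \<Rightarrow> 'a minor) \<Rightarrow> ('r, 'a) position \<Rightarrow> ('r, 'a) move \<Rightarrow> bool" where
  "legal_choice \<mu> = (\<lambda>(s, \<A>, \<B>) m.
     map length (vars m) = qtype (quan m) \<and>
     (\<forall>p\<in>\<A>. (univ (fst p), fst (wit m p), snd (wit m p)) \<in> fst (\<mu> (quan m))) \<and>
     (\<forall>p\<in>\<B>. (univ (fst p), fst (wit m p), snd (wit m p)) \<in> snd (\<mu> (quan m))))"

definition next_position ::
    "('r, 'a) position \<Rightarrow> ('r, 'a) move \<Rightarrow> nat \<Rightarrow> ('r, 'a) position" where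
  "next_position = (\<lambda>(s, \<A>, \<B>) m j.
     (s - cost (quan m),
      {(\<CC>, h(vars m ! j [\<mapsto>] cs)) | \<CC> h cs. (\<CC>, h) \<in> \<A> \<union> \<B> \<and> cs \<in> fst (wit m (\<CC>, h)) ! j},
      {(\<CC>, h(vars m ! j [\<mapsto>] cs)) | \<CC> h cs. (\<CC>, h) \<in> \<A> \<union> \<B> \<and> cs \<in> snd (wit m (\<CC>, h)) ! j}))"

definition wins_round ::
    "'r set \<Rightarrow> ('r \<Rightarrow> nat) \<Rightarrow> ('r, 'a) position \<Rightarrow> ('r, 'a) move \<Rightarrow> bool" where
  "wins_round \<tau> ar = (\<lambda>(s, \<A>, \<B>) m.
     0 \<le> s \<and> tau_atom \<tau> ar (atom m) \<and> separates (atom m) \<A> \<B>)"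

definition continues_round ::
    "'r set \<Rightarrow> ('r \<Rightarrow> nat) \<Rightarrow> (quant \<Rightarrow> 'a minor) \<Rightarrow> ('r, 'a) position \<Rightarrow> ('r, 'a) move \<Rightarrow> bool"
  where
  "continues_round \<tau> ar \<mu> = (\<lambda>(s, \<A>, \<B>) m.
     0 \<le> s \<and> tau_atom \<tau> ar (atom m) \<and> \<not> separates (atom m) \<A> \<B> \<and>
     legal_choice \<mu> (s, \<A>, \<B>) m)"

text \<open>
  A strategy of Player I maps the history of completed rounds (his move and the branch chosen
  by Player II) to a move.  A strategy and the sequence \<open>js\<close> of branches chosen by Player II
  determine the play; what happens after the play has been decided is ignored.
\<close>

type_synonym ('r, 'a) strategy = "(('r, 'a) move \<times> nat) list \<Rightarrow> ('r, 'a) move"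

primrec history :: "('r, 'a) strategy \<Rightarrow> (nat \<Rightarrow> nat) \<Rightarrow> nat \<Rightarrow> (('r, 'a) move \<times> nat) list" where
  "history \<sigma> js 0 = []"
| "history \<sigma> js (Suc i) = history \<sigma> js i @ [(\<sigma> (history \<sigma> js i), js i)]"

primrec position_at ::
    "('r, 'a) position \<Rightarrow> ('r, 'a) strategy \<Rightarrow> (nat \<Rightarrow> nat) \<Rightarrow> nat \<Rightarrow> ('r, 'a) position" where
  "position_at p \<sigma> js 0 = p"
| "position_at p \<sigma> js (Suc i) =
     next_position (position_at p \<sigma> js i) (\<sigma> (history \<sigma> js i)) (js i)"

text \<open>
  Player I wins a play if he wins some round after all earlier rounds have continued; all other
  plays (negative budget, no legal choice, infinitely many rounds) are won by Player II.
\<close>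

definition wins_play :: "'r set \<Rightarrow> ('r \<Rightarrow> nat) \<Rightarrow> (quant \<Rightarrow> 'a minor) \<Rightarrow>
    ('r, 'a) position \<Rightarrow> ('r, 'a) strategy \<Rightarrow> (nat \<Rightarrow> nat) \<Rightarrow> bool" where
  "wins_play \<tau> ar \<mu> p \<sigma> js \<longleftrightarrow>
     (\<exists>i. wins_round \<tau> ar (position_at p \<sigma> js i) (\<sigma> (history \<sigma> js i)) \<and>
          (\<forall>l<i. continues_round \<tau> ar \<mu> (position_at p \<sigma> js l) (\<sigma> (history \<sigma> js l))))"

text \<open>
  Restricting \<open>js\<close> to sequences of legal branches loses no play, since every width is positive.
\<close>

definition winning_strategy :: "'r set \<Rightarrow> ('r \<Rightarrow> nat) \<Rightarrow> (quant \<Rightarrow> 'a minor) \<Rightarrow>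
    ('r, 'a) position \<Rightarrow> ('r, 'a) strategy \<Rightarrow> bool" where
  "winning_strategy \<tau> ar \<mu> p \<sigma> \<longleftrightarrow>
     (\<forall>js. (\<forall>i. js i < length (qtype (quan (\<sigma> (history \<sigma> js i))))) \<longrightarrow>
        wins_play \<tau> ar \<mu> p \<sigma> js)"

end

theory Submission
  imports Defs
begin

text \<open>
  A formula is a tree whose inner nodes are quantifiers \<open>q\<close> applied to one formula per branch.
  Evaluating such a node at a pair \<open>(\<CC>, h)\<close> means asking whether \<open>gquant q\<close> contains the structure
  formed by the \<^emph>\<open>truth sets\<close> of the branch formulas, that is, the sets of tuples at which they hold
  (\<open>sat_combine\<close>).  In the game, Player I asserts that all pairs on the left satisfy the formula and
  that all pairs on the right falsify it.  He backs this with witness sets inside the truth sets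
  and falsifier sets disjoint from them, and the branch chosen by Player II asks him to make the
  same assertion about one of the branch formulas.

  Hence from a separating formula Player I reads off his moves: completeness of the minors
  provides sets compatible with the truth sets, and the branch formula separates the classes of the
  next position (\<open>force_win_if_winning_formula\<close>).  Conversely, suppose that every branch of his move
  is separated by some formula.  Then the sets he played are compatible with the truth sets of
  these formulas, and soundness of the minors says that the combined formula separates the present
  classes (\<open>winning_formula_combine\<close>).  In both directions the budget bounds the rank, since
  the copied budget corresponds to taking the maximum over the branches.

  Two points need care.  A branch may lead to a position without any pairs; then
  the formula obtained for it may have free variables outside the common domain of the assignments.
  Quantifiers being nontrivial, not all branches can be empty, and the formula of a nonempty branch
  also serves for the empty ones (\<open>winning_formula_if_force_win\<close>).  Moreover, strategies depend on
  histories and plays may be infinite.  Both disappear when the winning positions are described by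
  an inductive predicate \<open>force_win\<close>, whose induction principle then builds the formula.  A strategy
  can win only from such positions, because outside \<open>force_win\<close> Player II always has a branch that
  stays outside, so he wins or prolongs the play forever (\<open>force_win_if_winning_strategy\<close>).
\<close>

section \<open>Winning positions as an inductive predicate\<close>

inductive force_win ::
    "'r set \<Rightarrow> ('r \<Rightarrow> nat) \<Rightarrow> (quant \<Rightarrow> 'a minor) \<Rightarrow> ('r, 'a) position \<Rightarrow> bool"
  for \<tau> ar \<mu> where
  now: "wins_round \<tau> ar p m \<Longrightarrow> force_win \<tau> ar \<mu> p"
| later: "continues_round \<tau> ar \<mu> p m \<Longrightarrow>
    (\<And>j. j < length (qtype (quan m)) \<Longrightarrow> force_win \<tau> ar \<mu> (next_position p m j)) \<Longrightarrow>
    force_win \<tau> ar \<mu> p"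

lemma width_pos: "0 < length (qtype q)"
  by (cases q) auto

lemma history_Suc_shift:
  "history \<sigma> js (Suc i) =
     (\<sigma> [], js 0) # history (\<lambda>hs. \<sigma> ((\<sigma> [], js 0) # hs)) (\<lambda>i. js (Suc i)) i"
  by (induction i) auto

lemma position_at_Suc_shift:
  "position_at p \<sigma> js (Suc i) = position_at (next_position p (\<sigma> []) (js 0))
     (\<lambda>hs. \<sigma> ((\<sigma> [], js 0) # hs)) (\<lambda>i. js (Suc i)) i"
proof (induction i)
  case (Suc i)
  show ?case
    by (subst position_at.simps(2), subst Suc, subst history_Suc_shift) simp
qed simp

text \<open>
  After the opening round, a strategy continues as the strategy \<open>\<lambda>hs. \<sigma> ((\<sigma> [], js 0) # hs)\<close>,
  which has that round prefixed to its histories.  So strategies for the branches can be glued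
  together below a first move.
\<close>

lemma wins_play_shift:
  assumes "continues_round \<tau> ar \<mu> p (\<sigma> [])"
    and "wins_play \<tau> ar \<mu> (next_position p (\<sigma> []) (js 0))
      (\<lambda>hs. \<sigma> ((\<sigma> [], js 0) # hs)) (\<lambda>i. js (Suc i))"
  shows "wins_play \<tau> ar \<mu> p \<sigma> js"
proof -
  let ?p = "next_position p (\<sigma> []) (js 0)"
  let ?\<sigma> = "\<lambda>hs. \<sigma> ((\<sigma> [], js 0) # hs)" and ?js = "\<lambda>i. js (Suc i)"
  obtain i where win: "wins_round \<tau> ar (position_at ?p ?\<sigma> ?js i) (?\<sigma> (history ?\<sigma> ?js i))"
    and cont: "\<And>l. l < i \<Longrightarrow>
      continues_round \<tau> ar \<mu> (position_at ?p ?\<sigma> ?js l) (?\<sigma> (history ?\<sigma> ?js l))"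
    using assms(2) unfolding wins_play_def by blast
  have "wins_round \<tau> ar (position_at p \<sigma> js (Suc i)) (\<sigma> (history \<sigma> js (Suc i)))"
    using win unfolding position_at_Suc_shift history_Suc_shift .
  moreover have "continues_round \<tau> ar \<mu> (position_at p \<sigma> js l) (\<sigma> (history \<sigma> js l))"
    if "l < Suc i" for l
  proof (cases l)
    case 0
    then show ?thesis using assms(1) by simp
  next
    case (Suc k)
    then show ?thesis
      using that cont[of k] unfolding Suc position_at_Suc_shift history_Suc_shift by simp
  qed
  ultimately show ?thesis unfolding wins_play_def by blast
qed

lemma winning_strategy_if_force_win:
  assumes "force_win \<tau> ar \<mu> p"
  shows "\<exists>\<sigma>. winning_strategy \<tau> ar \<mu> p \<sigma>"
  using assms
proof induction
  case (now p m)
  then have "winning_strategy \<tau> ar \<mu> p (\<lambda>_. m)"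
    unfolding winning_strategy_def wins_play_def by (intro allI impI exI[of _ 0]) simp
  then show ?case by blast
next
  case (later p m)
  then have "\<forall>j. \<exists>\<sigma>. j < length (qtype (quan m)) \<longrightarrow>
      winning_strategy \<tau> ar \<mu> (next_position p m j) \<sigma>"
    by blast
  then obtain S where S: "\<And>j. j < length (qtype (quan m)) \<Longrightarrow>
      winning_strategy \<tau> ar \<mu> (next_position p m j) (S j)"
    by metis
  define \<sigma> where "\<sigma> hs = (case hs of [] \<Rightarrow> m | (_, j) # hs' \<Rightarrow> S j hs')" for hs
  have "wins_play \<tau> ar \<mu> p \<sigma> js"
    if js: "\<forall>i. js i < length (qtype (quan (\<sigma> (history \<sigma> js i))))" for js
  proof (rule wins_play_shift)
    show "continues_round \<tau> ar \<mu> p (\<sigma> [])"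
      using later.hyps by (simp add: \<sigma>_def)
    have shifted: "(\<lambda>hs. \<sigma> ((\<sigma> [], js 0) # hs)) = S (js 0)"
      by (simp add: \<sigma>_def)
    have "js (Suc i) < length (qtype (quan (S (js 0) (history (S (js 0)) (\<lambda>i. js (Suc i)) i))))"
      for i
      using js[rule_format, of "Suc i"] unfolding history_Suc_shift shifted by (simp add: \<sigma>_def)
    moreover have "js 0 < length (qtype (quan m))"
      using js[rule_format, of 0] by (simp add: \<sigma>_def)
    ultimately show "wins_play \<tau> ar \<mu> (next_position p (\<sigma> []) (js 0))
        (\<lambda>hs. \<sigma> ((\<sigma> [], js 0) # hs)) (\<lambda>i. js (Suc i))"
      using S[of "js 0"] unfolding shifted winning_strategy_def by (simp add: \<sigma>_def)
  qed
  then show ?case unfolding winning_strategy_def by blast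
qed

text \<open>
  The history of a play determines its position, so Player II can choose his branch as a function
  of the history.  Against a given strategy he keeps the position outside \<open>force_win\<close> as
  long as rounds continue, and there Player I cannot win a round.
\<close>

lemma force_win_if_winning_strategy:
  assumes win: "winning_strategy \<tau> ar \<mu> p \<sigma>"
  shows "force_win \<tau> ar \<mu> p"
proof (rule ccontr)
  assume lost: "\<not> force_win \<tau> ar \<mu> p"
  define pos where "pos hs = fold (\<lambda>(m, j) q. next_position q m j) hs p" for hs
  define c where "c hs = (SOME j. j < length (qtype (quan (\<sigma> hs))) \<and>
      (continues_round \<tau> ar \<mu> (pos hs) (\<sigma> hs) \<and> \<not> force_win \<tau> ar \<mu> (pos hs) \<longrightarrow>
        \<not> force_win \<tau> ar \<mu> (next_position (pos hs) (\<sigma> hs) j)))" for hs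
  have c: "c hs < length (qtype (quan (\<sigma> hs))) \<and>
      (continues_round \<tau> ar \<mu> (pos hs) (\<sigma> hs) \<and> \<not> force_win \<tau> ar \<mu> (pos hs) \<longrightarrow>
        \<not> force_win \<tau> ar \<mu> (next_position (pos hs) (\<sigma> hs) (c hs)))" for hs
    unfolding c_def
  proof (rule someI_ex, cases "continues_round \<tau> ar \<mu> (pos hs) (\<sigma> hs) \<and> \<not> force_win \<tau> ar \<mu> (pos hs)")
    case True
    then show "\<exists>j<length (qtype (quan (\<sigma> hs))). continues_round \<tau> ar \<mu> (pos hs) (\<sigma> hs) \<and>
        \<not> force_win \<tau> ar \<mu> (pos hs) \<longrightarrow> \<not> force_win \<tau> ar \<mu> (next_position (pos hs) (\<sigma> hs) j)"
      using force_win.later by metis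
  qed (use width_pos in blast)
  define hist where "hist = rec_nat [] (\<lambda>_ hs. hs @ [(\<sigma> hs, c hs)])"
  define js where "js i = c (hist i)" for i
  have hist: "history \<sigma> js i = hist i" for i
    by (induction i) (auto simp: hist_def js_def)
  have pos: "position_at p \<sigma> js i = pos (hist i)" for i
  proof (induction i)
    case (Suc i)
    then show ?case by (simp add: hist) (simp add: hist_def js_def pos_def)
  qed (simp add: hist_def pos_def)
  have "wins_play \<tau> ar \<mu> p \<sigma> js"
    using win c unfolding winning_strategy_def by (simp add: hist js_def)
  then obtain i where i: "wins_round \<tau> ar (pos (hist i)) (\<sigma> (hist i))"
    and cont: "\<And>l. l < i \<Longrightarrow> continues_round \<tau> ar \<mu> (pos (hist l)) (\<sigma> (hist l))"
    unfolding wins_play_def by (auto simp: hist pos)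
  have "l \<le> i \<Longrightarrow> \<not> force_win \<tau> ar \<mu> (pos (hist l))" for l
  proof (induction l)
    case 0
    then show ?case using lost by (simp add: hist_def pos_def)
  next
    case (Suc l)
    have "pos (hist (Suc l)) = next_position (pos (hist l)) (\<sigma> (hist l)) (c (hist l))"
      by (simp add: hist_def pos_def)
    then show ?case using Suc cont[of l] c[of "hist l"] by simp
  qed
  then show False using i force_win.now by blast
qed

section \<open>Minors and truth sets\<close>

lemma witnesses_soundD:
  assumes "witnesses n \<C> Q" "(D, Pp, Pm) \<in> \<C>" "(D, Ps) \<in> gstructs n" "compatible n D Pp Pm Ps"
  shows "(D, Ps) \<in> Q"
  using assms unfolding witnesses_def by blast

lemma witnesses_completeD:
  assumes "witnesses n \<C> Q" "(D, Ps) \<in> Q"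
  shows "\<exists>Pp Pm. (D, Pp, Pm) \<in> \<C> \<and> compatible n D Pp Pm Ps"
  using assms unfolding witnesses_def by blast

lemma witnesses_sstructsD:
  assumes "witnesses n \<C> Q" "(D, Pp, Pm) \<in> \<C>"
  shows "(D, Pp, Pm) \<in> sstructs n"
  using assms unfolding witnesses_def by blast

text \<open>
  Empty witness and falsifier sets are compatible with every structure on \<open>D\<close>.
\<close>

lemma witnesses_inhabited:
  assumes "witnesses n \<C> Q" "(D, Pp, Pm) \<in> \<C>" "(D, Ps) \<in> gstructs n - Q"
  shows "\<exists>j<length n. Pp ! j \<noteq> {} \<or> Pm ! j \<noteq> {}"
proof (rule ccontr)
  assume "\<not> ?thesis"
  then have "compatible n D Pp Pm Ps" by (simp add: compatible_def)
  then show False using witnesses_soundD[OF assms(1,2)] assms(3) by blast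
qed

lemma tuples_0: "tuples D 0 = {[]}"
  by (auto simp: tuples_def)

lemma tuples_1: "tuples D (Suc 0) = (\<lambda>c. [c]) ` D"
  by (auto simp: tuples_def length_Suc_conv)

lemma gquant_subset_gstructs: "gquant q \<subseteq> gstructs (qtype q)"
  by (cases q) auto

text \<open>
  On each domain a quantifier and its complement are both inhabited.  With \<open>witnesses_inhabited\<close>,
  every pair therefore contributes to at least one branch of a legal move.
\<close>

lemma gquant_nontrivial:
  assumes "D \<noteq> {}"
  shows "\<exists>Ps. (D, Ps) \<in> gquant q" and "\<exists>Ps. (D, Ps) \<in> gstructs (qtype q) - gquant q"
proof -
  let ?full = "map (tuples D) (qtype q)" and ?empty = "map (\<lambda>_. {}) (qtype q)"
  have gs: "(D, ?full) \<in> gstructs (qtype q)" "(D, ?empty) \<in> gstructs (qtype q)"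
    using assms by (auto simp: gstructs_def)
  have "tuples D (Suc 0) \<noteq> {}"
    using assms by (simp add: tuples_1)
  then have "(D, ?full) \<in> gquant q \<and> (D, ?empty) \<notin> gquant q \<or>
      (D, ?empty) \<in> gquant q \<and> (D, ?full) \<notin> gquant q"
    using gs by (cases q) (auto simp: tuples_0)
  then show "\<exists>Ps. (D, Ps) \<in> gquant q" "\<exists>Ps. (D, Ps) \<in> gstructs (qtype q) - gquant q"
    using gs by blast+
qed

fun combine :: "quant \<Rightarrow> var list list \<Rightarrow> (nat \<Rightarrow> 'r fm) \<Rightarrow> 'r fm" where
  "combine NegQ xs F = Neg (F 0)"
| "combine ConjQ xs F = Conj (F 0) (F 1)"
| "combine ForallQ xs F = Forall (hd (xs ! 0)) (F 0)"
| "combine ExistsQ xs F = Exists (hd (xs ! 0)) (F 0)"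

definition truth_sets ::
    "quant \<Rightarrow> var list list \<Rightarrow> (nat \<Rightarrow> 'r fm) \<Rightarrow> ('r, 'a) mpair \<Rightarrow> 'a list set list" where
  "truth_sets q xs F = (\<lambda>(\<CC>, h). map (\<lambda>j.
     {cs \<in> tuples (univ \<CC>) (qtype q ! j). sat \<CC> (h(xs ! j [\<mapsto>] cs)) (F j)}) [0..<length (qtype q)])"

lemma nth_truth_sets:
  assumes "j < length (qtype q)"
  shows "truth_sets q xs F (\<CC>, h) ! j =
    {cs \<in> tuples (univ \<CC>) (qtype q ! j). sat \<CC> (h(xs ! j [\<mapsto>] cs)) (F j)}"
  using assms by (simp add: truth_sets_def)

lemma truth_sets_gstructs:
  assumes "univ \<CC> \<noteq> {}"
  shows "(univ \<CC>, truth_sets q xs F (\<CC>, h)) \<in> gstructs (qtype q)"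
  using assms by (auto simp: gstructs_def nth_truth_sets) (simp add: truth_sets_def)

text \<open>
  The usual clauses of the semantics are those of the generalized quantifiers.
\<close>

lemma sat_combine:
  fixes \<CC> :: "('r, 'a) model"
  assumes ne: "univ \<CC> \<noteq> {}" and xs: "map length xs = qtype q"
  shows "sat \<CC> h (combine q xs F) \<longleftrightarrow> (univ \<CC>, truth_sets q xs F (\<CC>, h)) \<in> gquant q"
proof -
  note gs = truth_sets_gstructs[OF ne, of q xs F h]
  have full: "{cs \<in> T. P cs} = T \<longleftrightarrow> (\<forall>cs\<in>T. P cs)" for T :: "'a list set" and P
    by blast
  show ?thesis
  proof (cases q)
    case NegQ
    then show ?thesis
      using gs xs by (auto simp: nth_truth_sets tuples_0 Cons_eq_map_conv map_eq_Cons_conv)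
  next
    case ConjQ
    then show ?thesis
      using gs xs by (auto simp: nth_truth_sets tuples_0 map_eq_Cons_conv)
  next
    case ForallQ
    then obtain x where "xs = [[x]]"
      using xs by (auto simp: map_eq_Cons_conv length_Suc_conv)
    then show ?thesis
      using gs ForallQ by (auto simp: nth_truth_sets full) (auto simp: tuples_1)
  next
    case ExistsQ
    then obtain x where "xs = [[x]]"
      using xs by (auto simp: map_eq_Cons_conv length_Suc_conv)
    then show ?thesis
      using gs ExistsQ by (auto simp: nth_truth_sets tuples_1)
  qed
qed

lemma fv_combine:
  assumes "map length xs = qtype q"
  shows "fv (combine q xs F) \<subseteq> X \<longleftrightarrow> (\<forall>j<length (qtype q). fv (F j) \<subseteq> X \<union> set (xs ! j))"
  using assms by (cases q) (auto simp: map_eq_Cons_conv length_Suc_conv All_less_Suc)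

lemma tau_fm_combine:
  "tau_fm \<tau> ar (combine q xs F) \<longleftrightarrow> (\<forall>j<length (qtype q). tau_fm \<tau> ar (F j))"
  by (cases q) (auto simp: All_less_Suc)

lemma qrank_combine:
  "int (qrank (combine q xs F)) \<le> s \<longleftrightarrow> (\<forall>j<length (qtype q). int (qrank (F j)) \<le> s - cost q)"
  by (cases q) (auto simp: All_less_Suc of_nat_max)

section \<open>Formulas and winning positions\<close>

definition winning_formula ::
    "'r set \<Rightarrow> ('r \<Rightarrow> nat) \<Rightarrow> 'r fm \<Rightarrow> ('r, 'a) position \<Rightarrow> bool" where
  "winning_formula \<tau> ar \<phi> = (\<lambda>(s, \<A>, \<B>).
     tau_fm \<tau> ar \<phi> \<and> int (qrank \<phi>) \<le> s \<and> separates \<phi> \<A> \<B>)"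

lemma tau_atom_rank: "tau_atom \<tau> ar \<phi> \<Longrightarrow> tau_fm \<tau> ar \<phi> \<and> qrank \<phi> = 0"
  by (auto simp: tau_atom_def)

lemma separates_iff:
  "separates \<phi> \<A> \<B> \<longleftrightarrow>
     (\<forall>\<CC> h. (\<CC>, h) \<in> \<A> \<union> \<B> \<longrightarrow> fv \<phi> \<subseteq> dom h) \<and>
     (\<forall>\<CC> h. (\<CC>, h) \<in> \<A> \<longrightarrow> sat \<CC> h \<phi>) \<and> (\<forall>\<CC> h. (\<CC>, h) \<in> \<B> \<longrightarrow> \<not> sat \<CC> h \<phi>)"
  unfolding separates_def by (simp add: Ball_def split_paired_all)

definition position_pairs :: "('r, 'a) position \<Rightarrow> ('r, 'a) mpair set" where
  "position_pairs = (\<lambda>(s, \<A>, \<B>). \<A> \<union> \<B>)"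

lemma position_pairs_next:
  "p' \<in> position_pairs (next_position p m j) \<longleftrightarrow>
     (\<exists>\<CC> h cs. p' = (\<CC>, h(vars m ! j [\<mapsto>] cs)) \<and> (\<CC>, h) \<in> position_pairs p \<and>
       cs \<in> fst (wit m (\<CC>, h)) ! j \<union> snd (wit m (\<CC>, h)) ! j)"
  by (cases p) (simp add: position_pairs_def next_position_def, blast)

lemma winning_formula_next:
  "winning_formula \<tau> ar \<phi> (next_position (s, \<A>, \<B>) m j) \<longleftrightarrow>
     tau_fm \<tau> ar \<phi> \<and> int (qrank \<phi>) \<le> s - cost (quan m) \<and>
     (\<forall>\<CC> h. (\<CC>, h) \<in> \<A> \<union> \<B> \<longrightarrow>
       (\<forall>cs \<in> fst (wit m (\<CC>, h)) ! j \<union> snd (wit m (\<CC>, h)) ! j. fv \<phi> \<subseteq> dom (h(vars m ! j [\<mapsto>] cs))) \<and>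
       (\<forall>cs \<in> fst (wit m (\<CC>, h)) ! j. sat \<CC> (h(vars m ! j [\<mapsto>] cs)) \<phi>) \<and>
       (\<forall>cs \<in> snd (wit m (\<CC>, h)) ! j. \<not> sat \<CC> (h(vars m ! j [\<mapsto>] cs)) \<phi>))"
proof -
  have ball: "(\<forall>(\<CC>, h') \<in> {(\<CC>, h(vars m ! j [\<mapsto>] cs)) | \<CC> h cs. (\<CC>, h) \<in> \<A> \<union> \<B> \<and> cs \<in> G (\<CC>, h)}. P \<CC> h') \<longleftrightarrow>
      (\<forall>\<CC> h. (\<CC>, h) \<in> \<A> \<union> \<B> \<longrightarrow> (\<forall>cs \<in> G (\<CC>, h). P \<CC> (h(vars m ! j [\<mapsto>] cs))))" for G P
    by fast
  show ?thesis
    unfolding winning_formula_def next_position_def separates_def prod.case ball_Un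
      ball[of "\<lambda>p. fst (wit m p) ! j"] ball[of "\<lambda>p. snd (wit m p) ! j"]
    by (simp only: ball_Un imp_conjR all_conj_distrib)
qed

lemma winning_formula_empty:
  assumes "position_pairs p = {}"
  shows "winning_formula \<tau> ar \<phi> p \<longleftrightarrow> tau_fm \<tau> ar \<phi> \<and> int (qrank \<phi>) \<le> fst p"
  using assms by (cases p) (simp add: winning_formula_def position_pairs_def separates_iff)

lemma winning_formula_fv:
  "winning_formula \<tau> ar \<phi> p \<Longrightarrow> (\<CC>, h) \<in> position_pairs p \<Longrightarrow> fv \<phi> \<subseteq> dom h"
  by (cases p) (simp add: winning_formula_def position_pairs_def separates_iff, metis)

text \<open>
  At each pair, Player I plays sets from the minor that are compatible with the truth sets: from its
  first class if the pair satisfies the combined formula, from its second class otherwise.  Because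
  that formula separates, this is the class required on either side, and compatibility says
  precisely that \<open>F j\<close> separates the classes of branch \<open>j\<close>.
\<close>

lemma force_win_combine:
  fixes \<mu> :: "quant \<Rightarrow> 'a minor" and p :: "('r, 'a) position"
  assumes minor: "\<And>q. is_minor (qtype q) (gquant q) (\<mu> q)"
    and xs: "map length xs = qtype q"
    and \<phi>: "winning_formula \<tau> ar (combine q xs F) p"
    and ne: "\<forall>(\<CC>, h) \<in> position_pairs p. univ \<CC> \<noteq> {}"
    and branches: "\<And>j (p' :: ('r, 'a) position). j < length (qtype q) \<Longrightarrow> winning_formula \<tau> ar (F j) p' \<Longrightarrow>
      \<forall>(\<CC>, h) \<in> position_pairs p'. univ \<CC> \<noteq> {} \<Longrightarrow> force_win \<tau> ar \<mu> p'"
  shows "force_win \<tau> ar \<mu> p"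
proof -
  obtain s \<A> \<B> where p: "p = (s, \<A>, \<B>)" by (cases p)
  have sep: "separates (combine q xs F) \<A> \<B>" and s: "0 \<le> s"
    using \<phi> by (auto simp: winning_formula_def p)
  define ok where "ok \<CC> h W \<longleftrightarrow>
      (univ \<CC>, fst W, snd W) \<in> (if sat \<CC> h (combine q xs F) then fst else snd) (\<mu> q) \<and>
      compatible (qtype q) (univ \<CC>) (fst W) (snd W) (truth_sets q xs F (\<CC>, h))" for \<CC> h W
  have "\<exists>W. ok \<CC> h W" if "(\<CC>, h) \<in> \<A> \<union> \<B>" for \<CC> h
  proof -
    have ne': "univ \<CC> \<noteq> {}" using ne that by (auto simp: position_pairs_def p)
    note truth = sat_combine[OF ne' xs, of h F] truth_sets_gstructs[OF ne', of q xs F h]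
    show ?thesis
    proof (cases "sat \<CC> h (combine q xs F)")
      case True
      then obtain Pp Pm where "(univ \<CC>, Pp, Pm) \<in> fst (\<mu> q)"
        "compatible (qtype q) (univ \<CC>) Pp Pm (truth_sets q xs F (\<CC>, h))"
        using truth minor[of q] witnesses_completeD unfolding is_minor_def by blast
      then show ?thesis using True by (intro exI[of _ "(Pp, Pm)"]) (simp add: ok_def)
    next
      case False
      then have "(univ \<CC>, truth_sets q xs F (\<CC>, h)) \<in> gstructs (qtype q) - gquant q"
        using truth by blast
      then obtain Pp Pm where "(univ \<CC>, Pp, Pm) \<in> snd (\<mu> q)"
        "compatible (qtype q) (univ \<CC>) Pp Pm (truth_sets q xs F (\<CC>, h))"
        using minor[of q] witnesses_completeD unfolding is_minor_def by blast
      then show ?thesis using False by (intro exI[of _ "(Pp, Pm)"]) (simp add: ok_def)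
    qed
  qed
  then have "\<forall>c \<in> \<A> \<union> \<B>. \<exists>W. ok (fst c) (snd c) W"
    by (metis prod.collapse)
  then obtain w where "\<forall>c \<in> \<A> \<union> \<B>. ok (fst c) (snd c) (w c)"
    by (rule bchoice[THEN exE])
  then have w: "ok \<CC> h (w (\<CC>, h))" if "(\<CC>, h) \<in> \<A> \<union> \<B>" for \<CC> h
    using bspec[of "\<A> \<union> \<B>" _ "(\<CC>, h)"] that by (metis fst_conv snd_conv)
  define m where "m = \<lparr>atom = Eq 0 0, quan = q, vars = xs, wit = w\<rparr>"
  have quan_m: "quan m = q" by (simp add: m_def)
  have sep_next: "winning_formula \<tau> ar (F j) (next_position p m j)" if j: "j < length (qtype q)" for j
  proof -
    have compat: "fst (w (\<CC>, h)) ! j \<subseteq> {cs. sat \<CC> (h(xs ! j [\<mapsto>] cs)) (F j)} \<and>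
        snd (w (\<CC>, h)) ! j \<subseteq> {cs. \<not> sat \<CC> (h(xs ! j [\<mapsto>] cs)) (F j)} \<and>
        fst (w (\<CC>, h)) ! j \<union> snd (w (\<CC>, h)) ! j \<subseteq> tuples (univ \<CC>) (length (xs ! j))"
      if "(\<CC>, h) \<in> \<A> \<union> \<B>" for \<CC> h
    proof -
      have len: "length (xs ! j) = qtype q ! j"
        using j xs by (metis length_map nth_map)
      have "fst (w (\<CC>, h)) ! j \<subseteq> truth_sets q xs F (\<CC>, h) ! j \<and>
          snd (w (\<CC>, h)) ! j \<subseteq> tuples (univ \<CC>) (qtype q ! j) - truth_sets q xs F (\<CC>, h) ! j"
        using w[OF that] j by (simp add: ok_def compatible_def)
      then show ?thesis
        unfolding nth_truth_sets[OF j] len by blast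
    qed
    have fv: "fv (F j) \<subseteq> dom h \<union> set (xs ! j)" if "(\<CC>, h) \<in> \<A> \<union> \<B>" for \<CC> h
    proof -
      have "fv (combine q xs F) \<subseteq> dom h" using sep that unfolding separates_iff by blast
      then show ?thesis using j by (simp add: fv_combine[OF xs])
    qed
    have "fv (F j) \<subseteq> dom (h(xs ! j [\<mapsto>] cs))"
      if mem: "(\<CC>, h) \<in> \<A> \<union> \<B>" and cs: "cs \<in> fst (w (\<CC>, h)) ! j \<union> snd (w (\<CC>, h)) ! j" for \<CC> h cs
    proof -
      have "length cs = length (xs ! j)"
        using compat[OF mem] cs by (auto simp: tuples_def)
      then show ?thesis using fv[OF mem] by (simp add: Un_commute)
    qed
    moreover have "tau_fm \<tau> ar (F j) \<and> int (qrank (F j)) \<le> s - cost q"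
      using \<phi> j by (simp add: winning_formula_def p tau_fm_combine qrank_combine)
    moreover have "quan m = q" "vars m = xs" "wit m = w" by (simp_all add: m_def)
    ultimately show ?thesis
      using compat unfolding p winning_formula_next by simp blast
  qed
  have "force_win \<tau> ar \<mu> (next_position p m j)" if j: "j < length (qtype q)" for j
  proof (rule branches[OF j sep_next[OF j]])
    show "\<forall>(\<CC>, h) \<in> position_pairs (next_position p m j). univ \<CC> \<noteq> {}"
      using ne by (auto simp: position_pairs_next)
  qed
  moreover have "legal_choice \<mu> p m"
  proof -
    have "(univ (fst c), fst (w c), snd (w c)) \<in> fst (\<mu> q)" if "c \<in> \<A>" for c
      using w[of "fst c" "snd c"] that sep by (cases c) (simp add: ok_def separates_iff)
    moreover have "(univ (fst c), fst (w c), snd (w c)) \<in> snd (\<mu> q)" if "c \<in> \<B>" for c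
      using w[of "fst c" "snd c"] that sep by (cases c) (simp add: ok_def separates_iff)
    ultimately show ?thesis using xs by (auto simp: legal_choice_def p m_def)
  qed
  \<comment> \<open>Player I must also name an atomic formula; should \<open>Eq 0 0\<close> happen to separate, he wins at once.\<close>
  moreover have "wins_round \<tau> ar p m \<or> continues_round \<tau> ar \<mu> p m"
    using \<open>legal_choice \<mu> p m\<close> s
    by (auto simp: wins_round_def continues_round_def p m_def tau_atom_def)
  ultimately show ?thesis
    using force_win.now[of \<tau> ar p m \<mu>] force_win.later[of \<tau> ar \<mu> p m] quan_m by blast
qed

lemma force_win_if_winning_formula:
  fixes \<mu> :: "quant \<Rightarrow> 'a minor"
  assumes minor: "\<And>q. is_minor (qtype q) (gquant q) (\<mu> q)"
    and "winning_formula \<tau> ar \<phi> p" and "\<forall>(\<CC>, h) \<in> position_pairs p. univ \<CC> \<noteq> {}"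
  shows "force_win \<tau> ar \<mu> p"
  using assms(2,3)
proof (induction \<phi> arbitrary: p)
  case (Eq x y)
  then have "wins_round \<tau> ar p (undefined\<lparr>atom := Eq x y\<rparr>)"
    by (auto simp: wins_round_def winning_formula_def tau_atom_def)
  then show ?case by (rule force_win.now)
next
  case (Rel R xs)
  then have "wins_round \<tau> ar p (undefined\<lparr>atom := Rel R xs\<rparr>)"
    by (auto simp: wins_round_def winning_formula_def tau_atom_def)
  then show ?case by (rule force_win.now)
next
  case (Neg \<phi>)
  then show ?case
    by (intro force_win_combine[OF minor, of "[[]]" NegQ _ _ "\<lambda>_. \<phi>" p]) auto
next
  case (Conj \<phi> \<psi>)
  then show ?case
    by (intro force_win_combine[OF minor, of "[[], []]" ConjQ _ _ "\<lambda>j. if j = 0 then \<phi> else \<psi>" p])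
      (auto split: if_splits)
next
  case (Forall x \<phi>)
  then show ?case
    by (intro force_win_combine[OF minor, of "[[x]]" ForallQ _ _ "\<lambda>_. \<phi>" p]) auto
next
  case (Exists x \<phi>)
  then show ?case
    by (intro force_win_combine[OF minor, of "[[x]]" ExistsQ _ _ "\<lambda>_. \<phi>" p]) auto
qed

text \<open>
  Separation in every branch makes the sets played compatible with the truth sets of the branch
  formulas.  By soundness of the minor, membership of the resulting structure in the quantifier,
  hence the truth value of the combined formula, depends only on the side of the pair.

  The hypothesis on free variables does not follow from separation in the branches, for a pair need
  not contribute to every branch.
\<close>

lemma winning_formula_combine:
  assumes minor: "\<And>q. is_minor (qtype q) (gquant q) (\<mu> q)"
    and legal: "legal_choice \<mu> p m"
    and branches: "\<And>j. j < length (qtype (quan m)) \<Longrightarrow> winning_formula \<tau> ar (F j) (next_position p m j)"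
    and fv: "\<And>j \<CC> h. j < length (qtype (quan m)) \<Longrightarrow> (\<CC>, h) \<in> position_pairs p \<Longrightarrow>
      fv (F j) \<subseteq> dom h \<union> set (vars m ! j)"
  shows "winning_formula \<tau> ar (combine (quan m) (vars m) F) p"
proof -
  obtain s \<A> \<B> where p: "p = (s, \<A>, \<B>)" by (cases p)
  let ?q = "quan m" and ?xs = "vars m"
  have xs: "map length ?xs = qtype ?q"
    and left: "\<And>\<CC> h. (\<CC>, h) \<in> \<A> \<Longrightarrow> (univ \<CC>, fst (wit m (\<CC>, h)), snd (wit m (\<CC>, h))) \<in> fst (\<mu> ?q)"
    and right: "\<And>\<CC> h. (\<CC>, h) \<in> \<B> \<Longrightarrow> (univ \<CC>, fst (wit m (\<CC>, h)), snd (wit m (\<CC>, h))) \<in> snd (\<mu> ?q)"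
    using legal by (auto simp: legal_choice_def p)
  have C: "witnesses (qtype ?q) (fst (\<mu> ?q)) (gquant ?q)"
    and D: "witnesses (qtype ?q) (snd (\<mu> ?q)) (gstructs (qtype ?q) - gquant ?q)"
    using minor by (auto simp: is_minor_def)
  have compat: "compatible (qtype ?q) (univ \<CC>) (fst (wit m (\<CC>, h))) (snd (wit m (\<CC>, h)))
      (truth_sets ?q ?xs F (\<CC>, h))"
    and ne: "univ \<CC> \<noteq> {}"
    if mem: "(\<CC>, h) \<in> \<A> \<union> \<B>" for \<CC> h
  proof -
    have ss: "(univ \<CC>, fst (wit m (\<CC>, h)), snd (wit m (\<CC>, h))) \<in> sstructs (qtype ?q)"
      using mem left right C D witnesses_sstructsD by blast
    then show "univ \<CC> \<noteq> {}" by (simp add: sstructs_def)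
    have "sat \<CC> (h(?xs ! j [\<mapsto>] cs)) (F j)"
      if "j < length (qtype ?q)" "cs \<in> fst (wit m (\<CC>, h)) ! j" for j cs
      using branches[OF that(1)] that(2) mem unfolding p winning_formula_next by blast
    moreover have "\<not> sat \<CC> (h(?xs ! j [\<mapsto>] cs)) (F j)"
      if "j < length (qtype ?q)" "cs \<in> snd (wit m (\<CC>, h)) ! j" for j cs
      using branches[OF that(1)] that(2) mem unfolding p winning_formula_next by blast
    ultimately show "compatible (qtype ?q) (univ \<CC>) (fst (wit m (\<CC>, h))) (snd (wit m (\<CC>, h)))
        (truth_sets ?q ?xs F (\<CC>, h))"
      using ss by (fastforce simp: compatible_def sstructs_def nth_truth_sets)
  qed
  have "sat \<CC> h (combine ?q ?xs F)" if "(\<CC>, h) \<in> \<A>" for \<CC> h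
    using witnesses_soundD[OF C left[OF that] truth_sets_gstructs compat] that ne
    by (subst sat_combine[OF _ xs]) auto
  moreover have "\<not> sat \<CC> h (combine ?q ?xs F)" if "(\<CC>, h) \<in> \<B>" for \<CC> h
    using witnesses_soundD[OF D right[OF that] truth_sets_gstructs compat] that ne
    by (subst sat_combine[OF _ xs]) auto
  moreover have "fv (combine ?q ?xs F) \<subseteq> dom h" if "(\<CC>, h) \<in> \<A> \<union> \<B>" for \<CC> h
    using fv that unfolding fv_combine[OF xs] by (auto simp: position_pairs_def p)
  ultimately have "separates (combine ?q ?xs F) \<A> \<B>"
    unfolding separates_iff by blast
  moreover have "tau_fm \<tau> ar (F j) \<and> int (qrank (F j)) \<le> s - cost ?q"
    if "j < length (qtype ?q)" for j
    using branches[OF that] unfolding p winning_formula_next by blast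
  ultimately show ?thesis
    by (simp add: winning_formula_def p tau_fm_combine qrank_combine)
qed

text \<open>
  The common domain is an invariant of the game: in branch \<open>j\<close> it grows by the variables played there.
  If that branch contains a pair, the free variables of its formula lie in this domain.  Otherwise
  they are unrestricted, but any formula separates the empty classes, so that of a nonempty branch can
  be used instead.
\<close>

lemma winning_formula_if_force_win:
  fixes \<mu> :: "quant \<Rightarrow> 'a minor"
  assumes minor: "\<And>q. is_minor (qtype q) (gquant q) (\<mu> q)"
    and "force_win \<tau> ar \<mu> p" and "\<forall>(\<CC>, h) \<in> position_pairs p. dom h = X"
  shows "\<exists>\<phi>. winning_formula \<tau> ar \<phi> p"
  using assms(2,3)
proof (induction arbitrary: X)
  case (now p m)
  then have "winning_formula \<tau> ar (atom m) p"
    by (cases p) (auto simp: wins_round_def winning_formula_def dest: tau_atom_rank)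
  then show ?case by blast
next
  case (later p m)
  let ?q = "quan m" and ?xs = "vars m" and ?next = "next_position p m"
  let ?k = "length (qtype ?q)"
  have legal: "legal_choice \<mu> p m" and s: "0 \<le> fst p"
    using later.hyps(1) by (cases p; simp add: continues_round_def)+
  have xs: "map length ?xs = qtype ?q"
    using legal by (cases p) (simp add: legal_choice_def)
  show ?case
  proof (cases "position_pairs p = {}")
    case True
    \<comment> \<open>Any formula of rank \<open>0\<close> would do: there is no pair whose assignment must cover its variables.\<close>
    then have "winning_formula \<tau> ar (Eq 0 0) p"
      using s by (simp add: winning_formula_empty)
    then show ?thesis by blast
  next
    case False
    then obtain \<DD> g where g: "(\<DD>, g) \<in> position_pairs p" by auto
    have C: "witnesses (qtype ?q) (fst (\<mu> ?q)) (gquant ?q)"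
      and D: "witnesses (qtype ?q) (snd (\<mu> ?q)) (gstructs (qtype ?q) - gquant ?q)"
      using minor by (auto simp: is_minor_def)
    have ss: "(univ \<CC>, fst (wit m (\<CC>, h)), snd (wit m (\<CC>, h))) \<in> fst (\<mu> ?q) \<union> snd (\<mu> ?q)"
      if "(\<CC>, h) \<in> position_pairs p" for \<CC> h
      using legal that by (cases p) (auto simp: legal_choice_def position_pairs_def)
    have len: "length cs = length (?xs ! j)"
      if "(\<CC>, h) \<in> position_pairs p" "j < ?k"
        "cs \<in> fst (wit m (\<CC>, h)) ! j \<union> snd (wit m (\<CC>, h)) ! j" for \<CC> h j cs
    proof -
      have "cs \<in> tuples (univ \<CC>) (qtype ?q ! j)"
        using ss[OF that(1)] that(2,3) witnesses_sstructsD[OF C] witnesses_sstructsD[OF D]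
        by (fastforce simp: sstructs_def)
      then show ?thesis
        using that(2) xs by (metis (mono_tags, lifting) length_map mem_Collect_eq nth_map tuples_def)
    qed
    have dom: "\<forall>(\<CC>, h) \<in> position_pairs (?next j). dom h = X \<union> set (?xs ! j)" if "j < ?k" for j
    proof clarify
      fix \<CC> h' assume "(\<CC>, h') \<in> position_pairs (?next j)"
      then obtain h cs where h': "h' = h(?xs ! j [\<mapsto>] cs)" and h: "(\<CC>, h) \<in> position_pairs p"
        and cs: "cs \<in> fst (wit m (\<CC>, h)) ! j \<union> snd (wit m (\<CC>, h)) ! j"
        unfolding position_pairs_next by blast
      have "dom h = X" using later.prems h by auto
      then show "dom h' = X \<union> set (?xs ! j)"
        using len[OF h that cs] by (simp add: h' Un_commute)
    qed
    have "\<forall>j. \<exists>\<phi>. j < ?k \<longrightarrow> winning_formula \<tau> ar \<phi> (?next j)"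
      using later.IH[OF _ dom] by simp
    then obtain F where "\<forall>j. j < ?k \<longrightarrow> winning_formula \<tau> ar (F j) (?next j)"
      by (rule choice[THEN exE])
    then have F: "winning_formula \<tau> ar (F j) (?next j)" if "j < ?k" for j
      using that by blast
    have fv_F: "fv (F j) \<subseteq> X \<union> set (?xs ! j)" if j: "j < ?k" and ne: "position_pairs (?next j) \<noteq> {}" for j
    proof -
      obtain \<CC> h where h: "(\<CC>, h) \<in> position_pairs (?next j)" using ne by auto
      then have "dom h = X \<union> set (?xs ! j)" using bspec[OF dom[OF j] h] by simp
      then show ?thesis using winning_formula_fv[OF F[OF j] h] by simp
    qed
    have "\<exists>j<?k. fst (wit m (\<DD>, g)) ! j \<noteq> {} \<or> snd (wit m (\<DD>, g)) ! j \<noteq> {}"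
    proof -
      have ne: "univ \<DD> \<noteq> {}"
        using ss[OF g] witnesses_sstructsD[OF C] witnesses_sstructsD[OF D]
        by (fastforce simp: sstructs_def)
      from ss[OF g] show ?thesis
      proof
        assume "(univ \<DD>, fst (wit m (\<DD>, g)), snd (wit m (\<DD>, g))) \<in> fst (\<mu> ?q)"
        then show ?thesis
          using witnesses_inhabited[OF C] gquant_nontrivial(2)[OF ne, of ?q] by blast
      next
        assume "(univ \<DD>, fst (wit m (\<DD>, g)), snd (wit m (\<DD>, g))) \<in> snd (\<mu> ?q)"
        then show ?thesis
          using witnesses_inhabited[OF D] gquant_nontrivial(1)[OF ne, of ?q]
            gquant_subset_gstructs[of ?q] by blast
      qed
    qed
    then obtain i cs where i: "i < ?k" and "cs \<in> fst (wit m (\<DD>, g)) ! i \<union> snd (wit m (\<DD>, g)) ! i"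
      by blast
    then have "(\<DD>, g(?xs ! i [\<mapsto>] cs)) \<in> position_pairs (?next i)"
      using g unfolding position_pairs_next by blast
    then have nonempty: "position_pairs (?next i) \<noteq> {}" by blast
    define F' where "F' j = (if position_pairs (?next j) = {} then F i else F j)" for j
    have "tau_fm \<tau> ar (F i) \<and> int (qrank (F i)) \<le> fst (?next j)" for j
      using F[OF i] by (cases p) (simp add: winning_formula_def next_position_def)
    then have "winning_formula \<tau> ar (F' j) (?next j)" if "j < ?k" for j
      using F[OF that] by (simp add: F'_def winning_formula_empty)
    moreover have "fv (F' j) \<subseteq> X \<union> set (?xs ! j)" if "j < ?k" for j
    proof -
      \<comment> \<open>Branches of the same quantifier bind the same variables: only \<open>ConjQ\<close> has two, and it binds none.\<close>
      have "set (?xs ! j) = set (?xs ! i)"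
        using that i xs by (cases ?q) (auto simp: map_eq_Cons_conv less_Suc_eq)
      then show ?thesis using fv_F[of j] fv_F[OF i nonempty] that by (auto simp: F'_def)
    qed
    then have "fv (F' j) \<subseteq> dom h \<union> set (?xs ! j)"
      if "j < ?k" "(\<CC>, h) \<in> position_pairs p" for j \<CC> h
      using later.prems that by fastforce
    ultimately have "winning_formula \<tau> ar (combine ?q ?xs F') p"
      by (rule winning_formula_combine[OF minor legal])
    then show ?thesis by blast
  qed
qed

theorem theorem5p10:
  fixes \<tau> :: "'r set" and ar :: "'r \<Rightarrow> nat" and \<mu> :: "quant \<Rightarrow> 'a minor"
    and \<A> \<B> :: "('r, 'a) mpair set" and X :: "var set" and b :: nat
  assumes "finite \<tau>"
    and "\<And>q. is_minor (qtype q) (gquant q) (\<mu> q)"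
    and "\<A> \<subseteq> tau_pairs \<tau> ar" and "\<B> \<subseteq> tau_pairs \<tau> ar"
    and common_domain: "\<And>\<CC> h. (\<CC>, h) \<in> \<A> \<union> \<B> \<Longrightarrow> dom h = X"
  shows "(\<exists>\<sigma>. winning_strategy \<tau> ar \<mu> (int b, \<A>, \<B>) \<sigma>) \<longleftrightarrow>
         (\<exists>\<phi>. tau_fm \<tau> ar \<phi> \<and> qrank \<phi> \<le> b \<and> separates \<phi> \<A> \<B>)"
proof -
  let ?p = "(int b, \<A>, \<B>)"
  have ne: "\<forall>(\<CC>, h) \<in> position_pairs ?p. univ \<CC> \<noteq> {}"
    using assms(3,4) by (auto simp: position_pairs_def tau_pairs_def tau_model_def)
  have dom: "\<forall>(\<CC>, h) \<in> position_pairs ?p. dom h = X"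
    using common_domain by (auto simp: position_pairs_def)
  have "(\<exists>\<sigma>. winning_strategy \<tau> ar \<mu> ?p \<sigma>) \<longleftrightarrow> force_win \<tau> ar \<mu> ?p"
    using winning_strategy_if_force_win force_win_if_winning_strategy by metis
  also have "\<dots> \<longleftrightarrow> (\<exists>\<phi>. winning_formula \<tau> ar \<phi> ?p)"
    using winning_formula_if_force_win[OF assms(2) _ dom]
      force_win_if_winning_formula[OF assms(2) _ ne] by blast
  finally show ?thesis by (simp add: winning_formula_def)
qed

end
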